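(* Let $R$ be the ring of $k\times k$ matrices over a field, and let $x_1,x_2\in R$. There exists a polynomial of the form $F(x)=x^2+a_1x+a_0$ with $a_0,a_1\in R$ such that $x_1$ and $x_2$ are roots of $F(x)$ if and only if the rank of the matrix $(x_1-x_2)^T$ equals the rank of the $k\times 2k$ block matrix $$\left((x_1-x_2)^T \;\middle|\; (x_2^T)^2-(x_1^T)^2\right),$$ obtained by appending the rows of the matrix $(x_2^T)^2-(x_1^T)^2$ to the right of the corresponding rows of the matrix $(x_1-x_2)^T$.
   Context: Polynomials over $R$ are evaluated with coefficients on the left: for $F(x)=x^2+a_1x+a_0$ and $b\in R$, $F(b)=b^2+a_1b+a_0$, and $b$ is a root of $F(x)$ if $F(b)=0$. $F$ may have roots other than $x_1,x_2$. $A^T$ denotes the transpose of $A$. *)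

theory Defs
  imports
    Jordan_Normal_Form.DL_Rank
    "HOL-Algebra.Polynomial_Divisibility"
begin

abbreviation mat_ring :: "nat \<Rightarrow> 'a::field mat ring" where
  "mat_ring k \<equiv> ring_mat TYPE('a) k ()"

(* Column counterpart of append_rows: the two lower blocks have no rows. *)
definition append_cols :: "'a::zero mat \<Rightarrow> 'a mat \<Rightarrow> 'a mat" (infixr \<open>@\<^sub>c\<close> 65) where
  "A @\<^sub>c B = four_block_mat A B (0\<^sub>m 0 (dim_col A)) (0\<^sub>m 0 (dim_col B))"

lemma carrier_append_cols:
  assumes "A \<in> carrier_mat nr nc1" "B \<in> carrier_mat nr nc2"
  shows "A @\<^sub>c B \<in> carrier_mat nr (nc1 + nc2)"
  using assms unfolding append_cols_def by auto

lemma index_append_cols: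
  assumes "A \<in> carrier_mat nr nc1" "B \<in> carrier_mat nr nc2" "i < nr" "j < nc1 + nc2"
  shows "(A @\<^sub>c B) $$ (i, j) = (if j < nc1 then A $$ (i, j) else B $$ (i, j - nc1))"
  using assms unfolding append_cols_def by auto

(* Coefficient lists start with the leading coefficient, and ring.eval, which does not assume
   commutativity, multiplies coefficients from the left. *)
lemma is_root_monic_quadratic:
  fixes a0 a1 b :: "'a::field mat"
  assumes "a0 \<in> carrier_mat k k" "a1 \<in> carrier_mat k k" "b \<in> carrier_mat k k"
  shows "ring.is_root (mat_ring k) [\<one>\<^bsub>mat_ring k\<^esub>, a1, a0] b
    \<longleftrightarrow> b ^\<^sub>m 2 + a1 * b + a0 = 0\<^sub>m k k"
proof -
  interpret R: ring "mat_ring k :: 'a mat ring" by (rule ring_mat)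
  have c: "a0 \<in> carrier (mat_ring k)" "a1 \<in> carrier (mat_ring k)" "b \<in> carrier (mat_ring k)"
    using assms by (simp_all add: ring_mat_simps)
  have p: "b [^]\<^bsub>mat_ring k\<^esub> (2::nat) = b ^\<^sub>m 2"
    using pow_mat_ring_pow[OF assms(3), of 2 "()"] by simp
  have "R.eval [\<one>\<^bsub>mat_ring k\<^esub>, a1, a0] b
    = b [^]\<^bsub>mat_ring k\<^esub> (2::nat) \<oplus>\<^bsub>mat_ring k\<^esub> a1 \<otimes>\<^bsub>mat_ring k\<^esub> b \<oplus>\<^bsub>mat_ring k\<^esub> a0"
    using c by (simp add: R.a_assoc numeral_2_eq_2)
  then show ?thesis
    unfolding R.is_root_def p using c(3) by (simp add: ring_mat_simps)
qed

end

theory Submission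
  imports Defs
begin

text \<open>Subtracting the two root conditions eliminates the constant coefficient: they force
  \<open>a\<^sub>1 (x\<^sub>1 - x\<^sub>2) = x\<^sub>2\<^sup>2 - x\<^sub>1\<^sup>2\<close>, and any solution \<open>a\<^sub>1\<close> of this equation extends to a polynomial by
  taking \<open>a\<^sub>0 = -(x\<^sub>1\<^sup>2 + a\<^sub>1 x\<^sub>1)\<close> (\<open>monic_quadratic_through_two_roots_iff\<close>). The unknown stands on
  the left because coefficients do; transposing moves it to the right and gives a linear system
  \<open>A Y = B\<close> with the two blocks of the statement as \<open>A\<close> and \<open>B\<close>. Such a system is solvable exactly
  when the columns of \<open>B\<close> lie in the column space of \<open>A\<close>, that is, when appending them to
  \<open>A\<close> does not raise the rank (\<open>mat_equation_solvable_iff_rank\<close>, the Rouche-Capelli criterion for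
  several right-hand sides).\<close>

lemma set_cols_append_cols:
  assumes "A \<in> carrier_mat nr nc1" and "B \<in> carrier_mat nr nc2"
  shows "set (cols (A @\<^sub>c B)) = set (cols A) \<union> set (cols B)"
proof -
  have left: "col (A @\<^sub>c B) j = col A j" if "j < nc1" for j
    using assms that carrier_append_cols[OF assms]
    by (intro eq_vecI) (auto simp: index_append_cols[OF assms])
  have right: "col (A @\<^sub>c B) (nc1 + j) = col B j" if "j < nc2" for j
    using assms that carrier_append_cols[OF assms]
    by (intro eq_vecI) (auto simp: index_append_cols[OF assms])
  have "{0..<nc1 + nc2} = {0..<nc1} \<union> (+) nc1 ` {0..<nc2}"
    by (simp add: ivl_disj_un_two(3) add.commute)
  then have "set (cols (A @\<^sub>c B))
    = col (A @\<^sub>c B) ` {0..<nc1} \<union> (\<lambda>j. col (A @\<^sub>c B) (nc1 + j)) ` {0..<nc2}"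
    using carrier_append_cols[OF assms]
    by (simp add: cols_def image_Un image_image del: image_add_atLeastLessThan)
  also have "\<dots> = col A ` {0..<nc1} \<union> col B ` {0..<nc2}"
    using left right by (intro arg_cong2[of _ _ _ _ "(\<union>)"] image_cong) auto
  finally show ?thesis
    using assms by (simp add: cols_def)
qed

lemma (in vec_space) cols_in_col_space_iff_mat_equation_solvable:
  assumes A: "A \<in> carrier_mat n nc" and B: "B \<in> carrier_mat n nb"
  shows "set (cols B) \<subseteq> col_space A \<longleftrightarrow> (\<exists>Y \<in> carrier_mat nc nb. A * Y = B)"
proof
  assume "set (cols B) \<subseteq> col_space A"
  then have "col B j \<in> col_space A" if "j < nb" for j
    using B that by (auto simp: cols_def)
  then have "\<forall>j<nb. \<exists>x \<in> carrier_vec nc. A *\<^sub>v x = col B j"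
    using A by (simp add: col_space_eq[OF A])
  then obtain x where x: "x j \<in> carrier_vec nc" "A *\<^sub>v x j = col B j" if "j < nb" for j
    by metis
  define Y where "Y = mat_of_cols nc (map x [0..<nb])"
  have Y: "Y \<in> carrier_mat nc nb"
    unfolding Y_def by (rule carrier_matI) simp_all
  have "col Y j = x j" if "j < nb" for j
    using x(1)[OF that] that by (simp add: Y_def)
  then have "col (A * Y) j = col B j" if "j < nb" for j
    using that by (simp only: col_mult2[OF A Y] x(2))
  then have "A * Y = B"
    using A B Y by (intro mat_col_eqI) (auto simp del: col_mult2)
  with Y show "\<exists>Y \<in> carrier_mat nc nb. A * Y = B"
    by blast
next
  assume "\<exists>Y \<in> carrier_mat nc nb. A * Y = B"
  then obtain Y where Y: "Y \<in> carrier_mat nc nb" and AX: "A * Y = B"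
    by blast
  have "col B j \<in> col_space A" if "j < nb" for j
  proof -
    have "A *\<^sub>v col Y j = col B j"
      using col_mult2[OF A Y that] AX by simp
    moreover have "col Y j \<in> carrier_vec nc"
      using Y by auto
    ultimately show ?thesis
      using A B by (auto simp: col_space_eq[OF A])
  qed
  then show "set (cols B) \<subseteq> col_space A"
    using B by (auto simp: cols_def)
qed

text \<open>A column of \<open>B\<close> outside the column space of \<open>A\<close> enlarges a maximal linearly independent set of
  columns of \<open>A\<close>, so it raises the rank; columns inside leave the span unchanged.\<close>

lemma (in vec_space) rank_append_cols_eq_iff:
  assumes A: "A \<in> carrier_mat n nc" and B: "B \<in> carrier_mat n nb"
  shows "rank A = rank (A @\<^sub>c B) \<longleftrightarrow> set (cols B) \<subseteq> col_space A"
proof -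
  have colsA: "set (cols A) \<subseteq> carrier_vec n" and colsB: "set (cols B) \<subseteq> carrier_vec n"
    using A B cols_dim by blast+
  show ?thesis
  proof
    assume rank: "rank A = rank (A @\<^sub>c B)"
    show "set (cols B) \<subseteq> col_space A"
    proof (rule subsetI, rule ccontr)
      fix v
      assume v: "v \<in> set (cols B)" and "v \<notin> col_space A"
      have "lin_indpt {}"
        by (simp add: lin_dep_def)
      then obtain S where S: "finite S" "maximal S (\<lambda>T. T \<subseteq> set (cols A) \<and> lin_indpt T)"
        using maximal_exists_superset[of "set (cols A)"
            "\<lambda>T. T \<subseteq> set (cols A) \<and> lin_indpt T" "{}"]
        by auto
      then have sub: "S \<subseteq> set (cols A)" and indpt: "lin_indpt S"
        by (auto simp: maximal_def)
      have "v \<notin> span S"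
        using \<open>v \<notin> col_space A\<close> span_is_monotone[OF sub] by (auto simp: col_space_def)
      moreover have "v \<notin> S"
        using calculation sub colsA span_mem by auto
      moreover have "v \<in> carrier V"
        using v colsB by auto
      ultimately have "lin_indpt (S \<union> {v})"
        using lin_dep_iff_in_span[of S v] sub colsA indpt by auto
      moreover have "S \<union> {v} \<subseteq> set (cols (A @\<^sub>c B))"
        using sub v by (auto simp: set_cols_append_cols[OF A B])
      ultimately have "card (S \<union> {v}) \<le> rank (A @\<^sub>c B)"
        using rank_ge_card_indpt[OF carrier_append_cols[OF A B]] by blast
      moreover have "card (S \<union> {v}) = Suc (rank A)"
        using S \<open>v \<notin> S\<close> rank_card_indpt[OF A S(2)] by simp
      ultimately show False
        using rank by simp
    qed
  next
    assume "set (cols B) \<subseteq> col_space A"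
    then have "set (cols A) \<union> set (cols B) \<subseteq> span (set (cols A))"
      using in_own_span[of "set (cols A)"] colsA by (simp add: col_space_def)
    then have "span (set (cols A) \<union> set (cols B)) = span (set (cols A))"
      by (intro equalityI span_subsetI[OF colsA] span_is_monotone Un_upper1)
    then show "rank A = rank (A @\<^sub>c B)"
      by (simp add: rank_def set_cols_append_cols[OF A B])
  qed
qed

lemma (in vec_space) mat_equation_solvable_iff_rank:
  assumes "A \<in> carrier_mat n nc" and "B \<in> carrier_mat n nb"
  shows "(\<exists>Y \<in> carrier_mat nc nb. A * Y = B) \<longleftrightarrow> rank A = rank (A @\<^sub>c B)"
  using cols_in_col_space_iff_mat_equation_solvable[OF assms] rank_append_cols_eq_iff[OF assms]
  by simp

lemma monic_quadratic_through_two_roots_iff: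
  fixes a1 x1 x2 :: "'a::field mat"
  assumes x1: "x1 \<in> carrier_mat k k" and x2: "x2 \<in> carrier_mat k k"
    and a1: "a1 \<in> carrier_mat k k"
  shows "(\<exists>a0 \<in> carrier_mat k k. x1 ^\<^sub>m 2 + a1 * x1 + a0 = 0\<^sub>m k k
            \<and> x2 ^\<^sub>m 2 + a1 * x2 + a0 = 0\<^sub>m k k)
    \<longleftrightarrow> a1 * (x1 - x2) = x2 ^\<^sub>m 2 - x1 ^\<^sub>m 2"
proof -
  \<comment> \<open>Only additive relations remain once these matrices are treated as atoms.\<close>
  define p1 p2 q1 q2 where "p1 = x1 ^\<^sub>m 2" and "p2 = x2 ^\<^sub>m 2" and "q1 = a1 * x1" and "q2 = a1 * x2"
  have c: "p1 \<in> carrier_mat k k" "p2 \<in> carrier_mat k k" "q1 \<in> carrier_mat k k" "q2 \<in> carrier_mat k k"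
    using assms by (simp_all add: p1_def p2_def q1_def q2_def)
  have "(\<exists>a0 \<in> carrier_mat k k. p1 + q1 + a0 = 0\<^sub>m k k \<and> p2 + q2 + a0 = 0\<^sub>m k k)
    \<longleftrightarrow> q1 - q2 = p2 - p1"
  proof
    assume "\<exists>a0 \<in> carrier_mat k k. p1 + q1 + a0 = 0\<^sub>m k k \<and> p2 + q2 + a0 = 0\<^sub>m k k"
    then obtain a0 where a0: "a0 \<in> carrier_mat k k"
      and roots: "p1 + q1 + a0 = 0\<^sub>m k k" "p2 + q2 + a0 = 0\<^sub>m k k"
      by blast
    show "q1 - q2 = p2 - p1"
    proof (rule eq_matI)
      fix i j
      assume "i < dim_row (p2 - p1)" "j < dim_col (p2 - p1)"
      then have ij: "i < k" "j < k"
        using c by auto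
      have "p1 $$ (i, j) + q1 $$ (i, j) + a0 $$ (i, j) = 0"
        using arg_cong[OF roots(1), of "\<lambda>M. M $$ (i, j)"] c a0 ij by (simp add: add.assoc)
      moreover have "p2 $$ (i, j) + q2 $$ (i, j) + a0 $$ (i, j) = 0"
        using arg_cong[OF roots(2), of "\<lambda>M. M $$ (i, j)"] c a0 ij by (simp add: add.assoc)
      ultimately have "p1 $$ (i, j) + q1 $$ (i, j) = p2 $$ (i, j) + q2 $$ (i, j)"
        by (metis add_right_cancel)
      then show "(q1 - q2) $$ (i, j) = (p2 - p1) $$ (i, j)"
        using c ij by (simp add: algebra_simps)
    qed (use c in auto)
  next
    assume eq: "q1 - q2 = p2 - p1"
    have "p2 + q2 + - (p1 + q1) = 0\<^sub>m k k"
    proof (rule eq_matI)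
      fix i j
      assume "i < dim_row (0\<^sub>m k k :: 'a mat)" "j < dim_col (0\<^sub>m k k :: 'a mat)"
      then have ij: "i < k" "j < k"
        by auto
      have "(q1 - q2) $$ (i, j) = (p2 - p1) $$ (i, j)"
        using eq by simp
      then show "(p2 + q2 + - (p1 + q1)) $$ (i, j) = 0\<^sub>m k k $$ (i, j)"
        using c ij by (simp add: algebra_simps)
    qed (use c in auto)
    moreover have "p1 + q1 + - (p1 + q1) = 0\<^sub>m k k"
      using c by (intro eq_matI) auto
    ultimately show "\<exists>a0 \<in> carrier_mat k k. p1 + q1 + a0 = 0\<^sub>m k k \<and> p2 + q2 + a0 = 0\<^sub>m k k"
      using c by (intro bexI[of _ "- (p1 + q1)"]) auto
  qed
  then show ?thesis
    using assms by (simp add: p1_def p2_def q1_def q2_def mult_minus_distrib_mat)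
qed

lemma transpose_mat_square:
  fixes x :: "'a::comm_semiring_1 mat"
  assumes "x \<in> carrier_mat k k"
  shows "transpose_mat (x ^\<^sub>m 2) = transpose_mat x ^\<^sub>m 2"
  using assms by (simp add: numeral_2_eq_2 transpose_mult[OF assms assms])

lemma left_equation_solvable_iff_transpose:
  fixes D C :: "'a::comm_semiring_0 mat"
  assumes D: "D \<in> carrier_mat nr nc" and C: "C \<in> carrier_mat m nc"
  shows "(\<exists>Z \<in> carrier_mat m nr. Z * D = C)
    \<longleftrightarrow> (\<exists>Y \<in> carrier_mat nr m. transpose_mat D * Y = transpose_mat C)"
proof
  assume "\<exists>Z \<in> carrier_mat m nr. Z * D = C"
  then obtain Z where Z: "Z \<in> carrier_mat m nr" and "Z * D = C"
    by blast
  then have "transpose_mat D * transpose_mat Z = transpose_mat C"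
    using transpose_mult[OF Z D] by simp
  with Z show "\<exists>Y \<in> carrier_mat nr m. transpose_mat D * Y = transpose_mat C"
    by (intro bexI[of _ "transpose_mat Z"]) auto
next
  assume "\<exists>Y \<in> carrier_mat nr m. transpose_mat D * Y = transpose_mat C"
  then obtain Y where Y: "Y \<in> carrier_mat nr m" and eq: "transpose_mat D * Y = transpose_mat C"
    by blast
  have "transpose_mat (transpose_mat Y * D) = transpose_mat C"
    using transpose_mult[of "transpose_mat Y" m nr D nc] Y D eq by simp
  then have "transpose_mat Y * D = C"
    by (metis transpose_transpose)
  with Y show "\<exists>Z \<in> carrier_mat m nr. Z * D = C"
    by (intro bexI[of _ "transpose_mat Y"]) auto
qed

theorem theorem4:
  fixes k :: nat and x1 x2 :: "'a::field mat"
  assumes "x1 \<in> carrier (mat_ring k)" and "x2 \<in> carrier (mat_ring k)"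
  shows "(\<exists>a0 \<in> carrier (mat_ring k). \<exists>a1 \<in> carrier (mat_ring k).
            ring.is_root (mat_ring k) [\<one>\<^bsub>mat_ring k\<^esub>, a1, a0] x1 \<and>
            ring.is_root (mat_ring k) [\<one>\<^bsub>mat_ring k\<^esub>, a1, a0] x2)
    \<longleftrightarrow> vec_space.rank k (transpose_mat (x1 - x2))
        = vec_space.rank k
            (transpose_mat (x1 - x2) @\<^sub>c
              ((transpose_mat x2) ^\<^sub>m 2 - (transpose_mat x1) ^\<^sub>m 2))"
    (is "?roots \<longleftrightarrow> ?ranks")
proof -
  have x: "x1 \<in> carrier_mat k k" "x2 \<in> carrier_mat k k"
    using assms by (simp_all add: ring_mat_simps)
  have squares: "x2 ^\<^sub>m 2 - x1 ^\<^sub>m 2 \<in> carrier_mat k k"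
    using x by (intro minus_carrier_mat pow_carrier_mat)
  have transpose_squares:
    "transpose_mat (x2 ^\<^sub>m 2 - x1 ^\<^sub>m 2) = (transpose_mat x2) ^\<^sub>m 2 - (transpose_mat x1) ^\<^sub>m 2"
    using x transpose_minus[of "x2 ^\<^sub>m 2" k k "x1 ^\<^sub>m 2"] by (simp add: transpose_mat_square)
  have "?roots \<longleftrightarrow> (\<exists>a1 \<in> carrier_mat k k. \<exists>a0 \<in> carrier_mat k k.
      x1 ^\<^sub>m 2 + a1 * x1 + a0 = 0\<^sub>m k k \<and> x2 ^\<^sub>m 2 + a1 * x2 + a0 = 0\<^sub>m k k)"
    unfolding ring_mat_simps(5) using is_root_monic_quadratic x by (metis (no_types, lifting))
  also have "\<dots> \<longleftrightarrow> (\<exists>a1 \<in> carrier_mat k k. a1 * (x1 - x2) = x2 ^\<^sub>m 2 - x1 ^\<^sub>m 2)"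
    using monic_quadratic_through_two_roots_iff[OF x] by (intro bex_cong) auto
  also have "\<dots> \<longleftrightarrow> (\<exists>Y \<in> carrier_mat k k. transpose_mat (x1 - x2) * Y
      = (transpose_mat x2) ^\<^sub>m 2 - (transpose_mat x1) ^\<^sub>m 2)"
    using left_equation_solvable_iff_transpose[OF minus_carrier_mat[OF x(2)] squares]
    by (simp add: transpose_squares)
  also have "\<dots> \<longleftrightarrow> ?ranks"
    using x by (intro vec_space.mat_equation_solvable_iff_rank) auto
  finally show ?thesis .
qed

end
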